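(* Let $\alpha\in\mathbb{R}\setminus\{0\}$, $\beta>0$ and let $\mathbf{X}\in\mathbb{T}_{\alpha\beta}^{p\times p}$ be written as $\mathbf{X}=\mathbf{X}_s\mathrm{w}_1+\mathbf{X}_d\mathrm{w}_2$ with $\mathbf{X}_s,\mathbf{X}_d\in\mathbb{C}_\alpha^{p\times p}$. Then $\mathbf{X}$ possesses a square root $\mathbf{X}^{1/2}$ if and only if both $\mathbf{X}_s$ and $\mathbf{X}_d$ possess square roots $\mathbf{X}_s^{1/2}$ and $\mathbf{X}_d^{1/2}$. Moreover, if a square root of $\mathbf{X}$ exists, it is given by $$\mathbf{X}^{1/2}=\mathbf{C}+\mathbf{D}\mathrm{j},\qquad \mathbf{C}=\frac{\mathbf{X}_s^{1/2}+\mathbf{X}_d^{1/2}}{2},\qquad \mathbf{D}=\frac{\mathbf{X}_s^{1/2}-\mathbf{C}}{\sqrt{\beta}},$$ where $\mathbf{X}_s^{1/2}$ and $\mathbf{X}_d^{1/2}$ are square roots of $\mathbf{X}_s$ and $\mathbf{X}_d$. (Square roots need not be unique.)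
   Context: $\mathbb{T}_{\alpha\beta}$ (the $(\alpha\beta)$-tessarines) is the commutative, associative real algebra with basis $1,\mathrm{i},\mathrm{j},\mathrm{k}$ and multiplication $\mathrm{i}^2=\alpha$, $\mathrm{j}^2=\beta$, $\mathrm{k}^2=\alpha\beta$, $\mathrm{i}\mathrm{j}=\mathrm{k}$, $\mathrm{i}\mathrm{k}=\alpha\mathrm{j}$, $\mathrm{j}\mathrm{k}=\beta\mathrm{i}$. $\mathbb{C}_\alpha=\{a+b\mathrm{i}: a,b\in\mathbb{R}\}$. Put $\mathrm{w}_1=\frac{\sqrt\beta+\mathrm{j}}{2\sqrt\beta}$, $\mathrm{w}_2=\frac{\sqrt\beta-\mathrm{j}}{2\sqrt\beta}$. A matrix $\mathbf{X}=\mathbf{A}+\mathbf{B}\mathrm{i}+\mathbf{C}\mathrm{j}+\mathbf{D}\mathrm{k}$ with real $\mathbf{A},\mathbf{B},\mathbf{C},\mathbf{D}$ is written $\mathbf{X}=\mathbf{X}_s\mathrm{w}_1+\mathbf{X}_d\mathrm{w}_2$, where $\mathbf{X}_s=\mathbf{X}_a+\sqrt\beta\,\mathbf{X}_b$, $\mathbf{X}_d=\mathbf{X}_a-\sqrt\beta\,\mathbf{X}_b$, $\mathbf{X}_a=\mathbf{A}+\mathbf{B}\mathrm{i}$, $\mathbf{X}_b=\mathbf{C}+\mathbf{D}\mathrm{i}$. A square root of $\mathbf{Y}$ is a matrix $\mathbf{Y}^{1/2}$ with $\mathbf{Y}^{1/2}\mathbf{Y}^{1/2}=\mathbf{Y}$.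 Where square roots live: if $\alpha<0$, square roots of $\mathbf{X}$ have entries in $\mathbb{T}_{\alpha\beta}$ and those of $\mathbf{X}_s,\mathbf{X}_d$ have entries in $\mathbb{C}_\alpha$. If $\alpha>0$, square roots of $\mathbf{X}$ are allowed entries in the generalized $(\alpha\beta)$-tessarines $\mathbb{G}_{\alpha\beta}=\{x_1+x_2\epsilon: x_1,x_2\in\mathbb{T}_{\alpha\beta}\}$, the commutative algebra obtained by adjoining to $\mathbb{T}_{\alpha\beta}$ a unit $\epsilon$ with $\epsilon^2=-1$ commuting with $\mathrm{i},\mathrm{j},\mathrm{k}$, and those of $\mathbf{X}_s,\mathbf{X}_d$ are allowed entries of the form $a+b\epsilon+c\mathrm{i}+d\epsilon\mathrm{i}$, $a,b,c,d\in\mathbb{R}$. *)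

theory Defs
  imports "HOL-Analysis.Analysis"
begin

text \<open>
  A tessarine is given by its real coordinates with respect to the basis 1, i, j, k. The product
  depends on the two real parameters, hence it is an explicit function and not an instance of
  the class \<^class>\<open>times\<close>; addition and real scaling are those of the product vector space.
\<close>

type_synonym tess = "real \<times> real \<times> real \<times> real"

definition tess_1 :: tess where "tess_1 = (1, 0, 0, 0)"
definition tess_i :: tess where "tess_i = (0, 1, 0, 0)"
definition tess_j :: tess where "tess_j = (0, 0, 1, 0)"
definition tess_k :: tess where "tess_k = (0, 0, 0, 1)"

fun tess_mult :: "real \<Rightarrow> real \<Rightarrow> tess \<Rightarrow> tess \<Rightarrow> tess" where
  "tess_mult \<alpha> \<beta> (a, b, c, d) (a', b', c', d') =
     (a * a' + \<alpha> * b * b' + \<beta> * c * c' + \<alpha> * \<beta> * d * d',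
      a * b' + b * a' + \<beta> * c * d' + \<beta> * d * c',
      a * c' + c * a' + \<alpha> * b * d' + \<alpha> * d * b',
      a * d' + d * a' + b * c' + c * b')"

lemma tess_mult_table:
  "tess_mult \<alpha> \<beta> tess_1 x = x"
  "tess_mult \<alpha> \<beta> tess_i tess_i = \<alpha> *\<^sub>R tess_1"
  "tess_mult \<alpha> \<beta> tess_j tess_j = \<beta> *\<^sub>R tess_1"
  "tess_mult \<alpha> \<beta> tess_k tess_k = (\<alpha> * \<beta>) *\<^sub>R tess_1"
  "tess_mult \<alpha> \<beta> tess_i tess_j = tess_k"
  "tess_mult \<alpha> \<beta> tess_i tess_k = \<alpha> *\<^sub>R tess_j"
  "tess_mult \<alpha> \<beta> tess_j tess_k = \<beta> *\<^sub>R tess_i"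
  by (cases x; simp add: tess_1_def tess_i_def tess_j_def tess_k_def)+

lemma tess_mult_commute: "tess_mult \<alpha> \<beta> x y = tess_mult \<alpha> \<beta> y x"
  by (cases x; cases y) (simp add: algebra_simps)

lemma tess_mult_assoc:
  "tess_mult \<alpha> \<beta> (tess_mult \<alpha> \<beta> x y) z = tess_mult \<alpha> \<beta> x (tess_mult \<alpha> \<beta> y z)"
  by (cases x; cases y; cases z) (simp add: algebra_simps)

lemma tess_mult_add_left:
  "tess_mult \<alpha> \<beta> (x + y) z = tess_mult \<alpha> \<beta> x z + tess_mult \<alpha> \<beta> y z"
  by (cases x; cases y; cases z) (simp add: algebra_simps)

lemma tess_mult_scaleR_left:
  "tess_mult \<alpha> \<beta> (r *\<^sub>R x) y = r *\<^sub>R tess_mult \<alpha> \<beta> x y"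
  by (cases x; cases y) (simp add: algebra_simps)

text \<open>The set underlying the subalgebra of all a + b i.\<close>

definition tess_C :: "tess set" where
  "tess_C = {a *\<^sub>R tess_1 + b *\<^sub>R tess_i | a b. True}"

definition tess_w1 :: "real \<Rightarrow> tess" where
  "tess_w1 \<beta> = (1 / (2 * sqrt \<beta>)) *\<^sub>R (sqrt \<beta> *\<^sub>R tess_1 + tess_j)"

definition tess_w2 :: "real \<Rightarrow> tess" where
  "tess_w2 \<beta> = (1 / (2 * sqrt \<beta>)) *\<^sub>R (sqrt \<beta> *\<^sub>R tess_1 - tess_j)"

text \<open>The pair (x1, x2) stands for x1 + x2 e, where e is the adjoined unit with square -1.\<close>

type_synonym gtess = "tess \<times> tess"

fun gtess_mult :: "real \<Rightarrow> real \<Rightarrow> gtess \<Rightarrow> gtess \<Rightarrow> gtess" where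
  "gtess_mult \<alpha> \<beta> (x1, x2) (y1, y2) =
     (tess_mult \<alpha> \<beta> x1 y1 - tess_mult \<alpha> \<beta> x2 y2,
      tess_mult \<alpha> \<beta> x1 y2 + tess_mult \<alpha> \<beta> x2 y1)"

definition of_tess :: "tess \<Rightarrow> gtess" where
  "of_tess x = (x, 0)"

lemma of_tess_mult:
  "of_tess (tess_mult \<alpha> \<beta> x y) = gtess_mult \<alpha> \<beta> (of_tess x) (of_tess y)"
  by (cases x; cases y) (simp add: of_tess_def zero_prod_def)

text \<open>
  Since the product of the entries is not a class operation, the matrix product and the product
  of a matrix with a scalar take it as an argument.
\<close>

definition mat_mult ::
    "('a \<Rightarrow> 'a \<Rightarrow> 'a::comm_monoid_add) \<Rightarrow> 'a^'n^'n \<Rightarrow> 'a^'n^'n \<Rightarrow> 'a^'n^'n" where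
  "mat_mult mul A B = (\<chi> i j. \<Sum>k\<in>UNIV. mul (A $ i $ k) (B $ k $ j))"

definition mat_scale :: "('a \<Rightarrow> 'a \<Rightarrow> 'a) \<Rightarrow> 'a^'n^'n \<Rightarrow> 'a \<Rightarrow> 'a^'n^'n" where
  "mat_scale mul A z = (\<chi> i j. mul (A $ i $ j) z)"

definition entries_in :: "'a set \<Rightarrow> 'a^'n^'n \<Rightarrow> bool" where
  "entries_in K A \<longleftrightarrow> (\<forall>i j. A $ i $ j \<in> K)"

definition of_tess_mat :: "tess^'n^'n \<Rightarrow> gtess^'n^'n" where
  "of_tess_mat A = (\<chi> i j. of_tess (A $ i $ j))"

text \<open>
  Where the entries of square roots live, as subsets of the generalized tessarines. For negative
  \<open>\<alpha>\<close> these are (the copies of) the tessarines, respectively of the elements a + b i. For positive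
  \<open>\<alpha>\<close> these are all generalized tessarines, respectively the elements a + b e + c i + d e i.
\<close>

definition root_dom_T :: "real \<Rightarrow> gtess set" where
  "root_dom_T \<alpha> = (if \<alpha> < 0 then range of_tess else UNIV)"

definition root_dom_C :: "real \<Rightarrow> gtess set" where
  "root_dom_C \<alpha> = (if \<alpha> < 0 then of_tess ` tess_C else tess_C \<times> tess_C)"

definition is_sqrt_in ::
    "gtess set \<Rightarrow> real \<Rightarrow> real \<Rightarrow> tess^'n^'n \<Rightarrow> gtess^'n^'n \<Rightarrow> bool" where
  "is_sqrt_in K \<alpha> \<beta> Y R \<longleftrightarrow>
     entries_in K R \<and> mat_mult (gtess_mult \<alpha> \<beta>) R R = of_tess_mat Y"

definition is_sqrt_T :: "real \<Rightarrow> real \<Rightarrow> tess^'n^'n \<Rightarrow> gtess^'n^'n \<Rightarrow> bool" where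
  "is_sqrt_T \<alpha> \<beta> = is_sqrt_in (root_dom_T \<alpha>) \<alpha> \<beta>"

definition is_sqrt_C :: "real \<Rightarrow> real \<Rightarrow> tess^'n^'n \<Rightarrow> gtess^'n^'n \<Rightarrow> bool" where
  "is_sqrt_C \<alpha> \<beta> = is_sqrt_in (root_dom_C \<alpha>) \<alpha> \<beta>"

text \<open>
  The decomposition of a matrix along the two idempotents always exists, is unique, and is given
  by the following explicit formulas.
\<close>

definition mat_s :: "real \<Rightarrow> tess^'n^'n \<Rightarrow> tess^'n^'n" where
  "mat_s \<beta> X = (\<chi> m n. case X $ m $ n of (a, b, c, d) \<Rightarrow>
     (a *\<^sub>R tess_1 + b *\<^sub>R tess_i) + sqrt \<beta> *\<^sub>R (c *\<^sub>R tess_1 + d *\<^sub>R tess_i))"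

definition mat_d :: "real \<Rightarrow> tess^'n^'n \<Rightarrow> tess^'n^'n" where
  "mat_d \<beta> X = (\<chi> m n. case X $ m $ n of (a, b, c, d) \<Rightarrow>
     (a *\<^sub>R tess_1 + b *\<^sub>R tess_i) - sqrt \<beta> *\<^sub>R (c *\<^sub>R tess_1 + d *\<^sub>R tess_i))"

lemma tess_mult_w1_w2:
  assumes "\<beta> > 0"
  shows "tess_mult \<alpha> \<beta> (s, t, 0, 0) (tess_w1 \<beta>) =
      (s / 2, t / 2, s / (2 * sqrt \<beta>), t / (2 * sqrt \<beta>))"
    and "tess_mult \<alpha> \<beta> (s, t, 0, 0) (tess_w2 \<beta>) =
      (s / 2, t / 2, - s / (2 * sqrt \<beta>), - t / (2 * sqrt \<beta>))"
  using assms by (simp_all add: tess_w1_def tess_w2_def tess_1_def tess_j_def)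

lemma tess_C_iff: "(a, b, c, d) \<in> tess_C \<longleftrightarrow> c = 0 \<and> d = 0"
  by (auto simp: tess_C_def tess_1_def tess_i_def)

lemma tess_decomposition:
  assumes "\<beta> > 0"
  shows "s \<in> tess_C \<and> t \<in> tess_C \<and>
      (a, b, c, d) = tess_mult \<alpha> \<beta> s (tess_w1 \<beta>) + tess_mult \<alpha> \<beta> t (tess_w2 \<beta>) \<longleftrightarrow>
    s = (a + sqrt \<beta> * c, b + sqrt \<beta> * d, 0, 0) \<and> t = (a - sqrt \<beta> * c, b - sqrt \<beta> * d, 0, 0)"
proof -
  obtain s1 s2 s3 s4 t1 t2 t3 t4 where st: "s = (s1, s2, s3, s4)" "t = (t1, t2, t3, t4)"
    by (metis prod_cases4)
  define r where "r = sqrt \<beta>"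
  have r: "r > 0"
    using assms by (simp add: r_def)
  have *: "a = x / 2 + y / 2 \<and> c = x / (2 * r) + - y / (2 * r) \<longleftrightarrow> x = a + r * c \<and> y = a - r * c"
    for a c x y :: real
  proof -
    have "c = x / (2 * r) + - y / (2 * r) \<longleftrightarrow> 2 * (r * c) = x - y"
      using r by (auto simp: field_simps)
    then show ?thesis by auto
  qed
  show ?thesis
  proof (cases "s3 = 0 \<and> s4 = 0 \<and> t3 = 0 \<and> t4 = 0")
    case True
    then show ?thesis
      using *[of a s1 t1 c] *[of b s2 t2 d]
      unfolding st r_def by (simp add: tess_C_iff tess_mult_w1_w2[OF assms]) blast
  next
    case False
    then show ?thesis
      unfolding st by (auto simp: tess_C_iff)
  qed
qed

lemma mat_decomposition:
  assumes "\<beta> > 0"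
  shows "entries_in tess_C Xs \<and> entries_in tess_C Xd \<and>
      X = mat_scale (tess_mult \<alpha> \<beta>) Xs (tess_w1 \<beta>) + mat_scale (tess_mult \<alpha> \<beta>) Xd (tess_w2 \<beta>)
    \<longleftrightarrow> Xs = mat_s \<beta> X \<and> Xd = mat_d \<beta> X"
proof -
  have *: "Xs $ m $ n \<in> tess_C \<and> Xd $ m $ n \<in> tess_C \<and>
      X $ m $ n = tess_mult \<alpha> \<beta> (Xs $ m $ n) (tess_w1 \<beta>) + tess_mult \<alpha> \<beta> (Xd $ m $ n) (tess_w2 \<beta>)
    \<longleftrightarrow> Xs $ m $ n = mat_s \<beta> X $ m $ n \<and> Xd $ m $ n = mat_d \<beta> X $ m $ n" for m n
  proof -
    obtain a b c d where X: "X $ m $ n = (a, b, c, d)"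
      by (metis prod_cases4)
    show ?thesis
      unfolding X tess_decomposition[OF assms]
      by (simp add: mat_s_def mat_d_def tess_1_def tess_i_def X zero_prod_def)
  qed
  show ?thesis
    unfolding entries_in_def vec_eq_iff mat_scale_def
    using * by (simp add: vec_eq_iff) blast
qed

end

theory Submission
  imports Defs
begin

text \<open>
  Substituting a real number \<open>r\<close> with \<open>r\<^sup>2 = \<beta>\<close> for j is an algebra homomorphism onto the subalgebra
  of all a + b i. The two substitutions \<open>r = \<plusminus>sqrt \<beta>\<close> are jointly injective, send X to its
  components \<open>X\<^sub>s\<close> and \<open>X\<^sub>d\<close>, and are inverted by the formula C + D j. Hence R is a square root of
  X exactly if its two images are square roots of \<open>X\<^sub>s\<close> and \<open>X\<^sub>d\<close>.
\<close>

definition subst_j :: "real \<Rightarrow> tess \<Rightarrow> tess" where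
  "subst_j r = (\<lambda>(a, b, c, d). (a + r * c, b + r * d, 0, 0))"

definition gsubst_j :: "real \<Rightarrow> gtess \<Rightarrow> gtess" where
  "gsubst_j r = map_prod (subst_j r) (subst_j r)"

lemma subst_j_simps [simp]: "subst_j r (a, b, c, d) = (a + r * c, b + r * d, 0, 0)"
  by (simp add: subst_j_def)

lemma gsubst_j_simps [simp]: "gsubst_j r (x, y) = (subst_j r x, subst_j r y)"
  by (simp add: gsubst_j_def)

lemma subst_j_0: "subst_j r 0 = 0"
  by (simp add: zero_prod_def)

lemma subst_j_add: "subst_j r (x + y) = subst_j r x + subst_j r y"
  by (cases x; cases y) (simp add: zero_prod_def distrib_left)

lemma subst_j_diff: "subst_j r (x - y) = subst_j r x - subst_j r y"
  by (cases x; cases y) (simp add: zero_prod_def right_diff_distrib)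

text \<open>Tessarines are polynomials in j over the elements a + b i, modulo j^2 = \<beta>, so
  evaluation at a real root of \<beta> respects products. Both \<open>r\<close> and
  \<open>- r\<close> qualify.\<close>

lemma subst_j_mult:
  assumes "r * r = \<beta>"
  shows "subst_j r (tess_mult \<alpha> \<beta> x y) = tess_mult \<alpha> \<beta> (subst_j r x) (subst_j r y)"
  unfolding assms [symmetric] by (cases x; cases y) (simp add: algebra_simps)

lemma subst_j_in_tess_C: "subst_j r x \<in> tess_C"
  by (cases x) (simp add: tess_C_iff)

text \<open>For x = p + q j the two values are p + r q and p - r q; half their sum is p and half
  their difference is r q, from which r can be cancelled.\<close>

lemma subst_j_eq_iff:
  assumes "r \<noteq> 0"
  shows "x = y \<longleftrightarrow> subst_j r x = subst_j r y \<and> subst_j (- r) x = subst_j (- r) y"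
proof -
  have "a = a' \<and> c = c'" if "a + r * c = a' + r * c'" "a - r * c = a' - r * c'" for a a' c c'
  proof -
    have "a = a'" "r * c = r * c'" using that by linarith+
    then show ?thesis using assms by simp
  qed
  then have *: "a = a' \<and> c = c' \<longleftrightarrow> a + r * c = a' + r * c' \<and> a - r * c = a' - r * c'" for a a' c c'
    by blast
  obtain a b c d a' b' c' d' where "x = (a, b, c, d)" "y = (a', b', c', d')"
    by (metis prod_cases4)
  then show ?thesis
    using * [of a a' c c'] * [of b b' d d'] by auto
qed

lemma gsubst_j_0: "gsubst_j r 0 = 0"
  by (simp add: zero_prod_def)

lemma gsubst_j_add: "gsubst_j r (x + y) = gsubst_j r x + gsubst_j r y"
  by (simp add: gsubst_j_def prod_eq_iff [of _ "_ + _"] subst_j_add)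

lemma gsubst_j_sum: "gsubst_j r (\<Sum>k\<in>A. f k) = (\<Sum>k\<in>A. gsubst_j r (f k))"
  by (induction A rule: infinite_finite_induct) (simp_all add: gsubst_j_0 gsubst_j_add)

lemma gsubst_j_mult:
  assumes "r * r = \<beta>"
  shows "gsubst_j r (gtess_mult \<alpha> \<beta> x y) = gtess_mult \<alpha> \<beta> (gsubst_j r x) (gsubst_j r y)"
  by (cases x; cases y) (simp only: gtess_mult.simps gsubst_j_simps subst_j_add subst_j_diff
    subst_j_mult [OF assms])

lemma gsubst_j_eq_iff:
  assumes "r \<noteq> 0"
  shows "x = y \<longleftrightarrow> gsubst_j r x = gsubst_j r y \<and> gsubst_j (- r) x = gsubst_j (- r) y"
  using subst_j_eq_iff [OF assms, of "fst x" "fst y"] subst_j_eq_iff [OF assms, of "snd x" "snd y"]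
  by (cases x; cases y) auto

lemma gsubst_j_of_tess: "gsubst_j r (of_tess x) = of_tess (subst_j r x)"
  by (simp add: of_tess_def subst_j_0)

text \<open>A bound common to both signs of \<alpha>, so that the inversion formula can be proved
  without a case distinction.\<close>

lemma root_dom_C_subset: "root_dom_C \<alpha> \<subseteq> tess_C \<times> tess_C"
proof -
  have "(0, 0, 0, 0) \<in> tess_C" by (simp add: tess_C_iff)
  then show ?thesis
    by (auto simp: root_dom_C_def of_tess_def zero_prod_def)
qed

text \<open>For negative \<alpha> both sides say that the coefficient of e vanishes, which the two
  substitutions detect by joint injectivity. Otherwise both sides hold for every \<open>z\<close>,
  because substitution always lands in \<open>tess_C\<close>.\<close>

lemma root_dom_T_iff:
  assumes "r \<noteq> 0"
  shows "z \<in> root_dom_T \<alpha> \<longleftrightarrow> gsubst_j r z \<in> root_dom_C \<alpha> \<and> gsubst_j (- r) z \<in> root_dom_C \<alpha>"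
proof -
  obtain x y where z: "z = (x, y)" by (cases z)
  have "z \<in> range of_tess \<longleftrightarrow> y = 0"
    by (auto simp: z of_tess_def)
  moreover have "gsubst_j s z \<in> of_tess ` tess_C \<longleftrightarrow> subst_j s y = 0" for s
    using subst_j_in_tess_C [of s x] by (auto simp: z of_tess_def)
  moreover have "y = 0 \<longleftrightarrow> subst_j r y = 0 \<and> subst_j (- r) y = 0"
    using subst_j_eq_iff [OF assms, of y 0] by (simp add: subst_j_0)
  ultimately show ?thesis
    by (simp add: root_dom_T_def root_dom_C_def z subst_j_in_tess_C)
qed

text \<open>Writing z = p + q j, the system s = p + r q, t = p - r q has the unique solution p = (s
  + t) / 2, q = (s - p) / r. Thus the formula inverts the pair of substitutions in both
  directions.\<close>

lemma gtess_eq_combination_iff: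
  assumes "r \<noteq> 0" and "s \<in> tess_C \<times> tess_C" and "t \<in> tess_C \<times> tess_C"
  shows "z = (1 / 2) *\<^sub>R (s + t) +
      gtess_mult \<alpha> \<beta> ((1 / r) *\<^sub>R (s - (1 / 2) *\<^sub>R (s + t))) (of_tess tess_j) \<longleftrightarrow>
    s = gsubst_j r z \<and> t = gsubst_j (- r) z"
proof -
  obtain s1 s2 s3 s4 t1 t2 t3 t4
    where s: "s = ((s1, s2, 0, 0), (s3, s4, 0, 0))" and t: "t = ((t1, t2, 0, 0), (t3, t4, 0, 0))"
    using assms(2,3) by (auto simp: tess_C_def tess_1_def tess_i_def)
  obtain z1 z2 z3 z4 z5 z6 z7 z8 where z: "z = ((z1, z2, z3, z4), (z5, z6, z7, z8))"
    by (metis prod_cases4 surj_pair)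
  \<comment> \<open>Multiplying an element free of j and k by j only moves its coordinates at 1 and
    i to j and k. The claim therefore splits into four copies of this real system: the pairs (1, j)
    and (i, k), each in both components of \<open>z\<close>.\<close>
  have *: "a = (x + y) / 2 \<and> c = (x - (x + y) / 2) / r \<longleftrightarrow> x = a + r * c \<and> y = a - r * c"
    for a c x y
  proof -
    have "c = (x - (x + y) / 2) / r \<longleftrightarrow> 2 * (r * c) = x - y"
      using assms(1) by (auto simp: field_simps)
    then show ?thesis by auto
  qed
  show ?thesis
    using * [of z1 s1 t1 z3] * [of z2 s2 t2 z4] * [of z5 s3 t3 z7] * [of z6 s4 t4 z8]
    unfolding s t z by (simp add: of_tess_def tess_j_def zero_prod_def) blast
qed

lemma map_matrix_mat_mult:
  assumes "r * r = \<beta>"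
  shows "map_matrix (gsubst_j r) (mat_mult (gtess_mult \<alpha> \<beta>) A B) =
    mat_mult (gtess_mult \<alpha> \<beta>) (map_matrix (gsubst_j r) A) (map_matrix (gsubst_j r) B)"
  by (simp add: vec_eq_iff map_matrix_def mat_mult_def gsubst_j_sum gsubst_j_mult [OF assms])

lemma map_matrix_of_tess_mat:
  "map_matrix (gsubst_j r) (of_tess_mat X) = of_tess_mat (map_matrix (subst_j r) X)"
  by (simp add: vec_eq_iff map_matrix_def of_tess_mat_def gsubst_j_of_tess)

lemma map_matrix_gsubst_j_eq_iff:
  assumes "r \<noteq> 0"
  shows "A = B \<longleftrightarrow> map_matrix (gsubst_j r) A = map_matrix (gsubst_j r) B \<and>
    map_matrix (gsubst_j (- r)) A = map_matrix (gsubst_j (- r)) B"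
proof -
  have "A $ i $ j = B $ i $ j \<longleftrightarrow> gsubst_j r (A $ i $ j) = gsubst_j r (B $ i $ j) \<and>
      gsubst_j (- r) (A $ i $ j) = gsubst_j (- r) (B $ i $ j)" for i j
    by (rule gsubst_j_eq_iff [OF assms])
  then show ?thesis
    unfolding vec_eq_iff map_matrix_def by (simp only: vec_lambda_beta) blast
qed

text \<open>The condition on the entries transfers by \<open>root_dom_T_iff\<close>; the equation
  transfers because the substitutions preserve matrix products and are jointly injective.\<close>

lemma is_sqrt_T_iff:
  assumes "r * r = \<beta>" and "r \<noteq> 0"
  shows "is_sqrt_T \<alpha> \<beta> X R \<longleftrightarrow>
    is_sqrt_C \<alpha> \<beta> (map_matrix (subst_j r) X) (map_matrix (gsubst_j r) R) \<and>
    is_sqrt_C \<alpha> \<beta> (map_matrix (subst_j (- r)) X) (map_matrix (gsubst_j (- r)) R)"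
proof -
  have minus: "(- r) * (- r) = \<beta>" using assms(1) by simp
  have "entries_in (root_dom_T \<alpha>) R \<longleftrightarrow> entries_in (root_dom_C \<alpha>) (map_matrix (gsubst_j r) R) \<and>
      entries_in (root_dom_C \<alpha>) (map_matrix (gsubst_j (- r)) R)"
    unfolding entries_in_def map_matrix_def root_dom_T_iff [OF assms(2)] by auto
  then show ?thesis
    \<comment> \<open>The homomorphism laws are used from right to left, so that both image
      equations become images of the one equation for \<open>R\<close>. Fixing the left matrix in
      the injectivity rule stops it from rewriting its own result.\<close>
    unfolding is_sqrt_T_def is_sqrt_C_def is_sqrt_in_def map_matrix_of_tess_mat [symmetric]
      map_matrix_mat_mult [OF assms(1), symmetric] map_matrix_mat_mult [OF minus, symmetric]
      map_matrix_gsubst_j_eq_iff [OF assms(2), of "mat_mult (gtess_mult \<alpha> \<beta>) R R"]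
    by blast
qed

lemma gtess_mat_eq_combination_iff:
  assumes "r \<noteq> 0" and "entries_in (tess_C \<times> tess_C) S" and "entries_in (tess_C \<times> tess_C) T"
  shows "R = (1 / 2) *\<^sub>R (S + T) +
      mat_scale (gtess_mult \<alpha> \<beta>) ((1 / r) *\<^sub>R (S - (1 / 2) *\<^sub>R (S + T))) (of_tess tess_j) \<longleftrightarrow>
    S = map_matrix (gsubst_j r) R \<and> T = map_matrix (gsubst_j (- r)) R"
proof -
  have "R $ i $ j = (1 / 2) *\<^sub>R (S $ i $ j + T $ i $ j) + gtess_mult \<alpha> \<beta>
        ((1 / r) *\<^sub>R (S $ i $ j - (1 / 2) *\<^sub>R (S $ i $ j + T $ i $ j))) (of_tess tess_j) \<longleftrightarrow>
      S $ i $ j = gsubst_j r (R $ i $ j) \<and> T $ i $ j = gsubst_j (- r) (R $ i $ j)" for i j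
    using assms by (intro gtess_eq_combination_iff) (auto simp only: entries_in_def)
  then show ?thesis
    unfolding vec_eq_iff map_matrix_def mat_scale_def
    by (simp only: vec_lambda_beta vector_add_component vector_minus_component
      vector_scaleR_component) blast
qed

theorem proposition4:
  fixes \<alpha> \<beta> :: real and X Xs Xd :: "tess^'n^'n"
  assumes "\<alpha> \<noteq> 0" and "\<beta> > 0"
    and "entries_in tess_C Xs" and "entries_in tess_C Xd"
    and "X = mat_scale (tess_mult \<alpha> \<beta>) Xs (tess_w1 \<beta>) + mat_scale (tess_mult \<alpha> \<beta>) Xd (tess_w2 \<beta>)"
  shows "((\<exists>R. is_sqrt_T \<alpha> \<beta> X R) \<longleftrightarrow>
            (\<exists>Rs. is_sqrt_C \<alpha> \<beta> Xs Rs) \<and> (\<exists>Rd. is_sqrt_C \<alpha> \<beta> Xd Rd)) \<and>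
         (\<forall>R. is_sqrt_T \<alpha> \<beta> X R \<longleftrightarrow>
            (\<exists>Rs Rd C D. is_sqrt_C \<alpha> \<beta> Xs Rs \<and> is_sqrt_C \<alpha> \<beta> Xd Rd \<and>
               C = (1 / 2) *\<^sub>R (Rs + Rd) \<and>
               D = (1 / sqrt \<beta>) *\<^sub>R (Rs - C) \<and>
               R = C + mat_scale (gtess_mult \<alpha> \<beta>) D (of_tess tess_j)))"
proof -
  define r where "r = sqrt \<beta>"
  have r: "r * r = \<beta>" "r \<noteq> 0"
    using assms(2) by (simp_all add: r_def)
  \<comment> \<open>The decomposition along the idempotents is unique, so the given components are
    the explicit ones, and these are the images of \<open>X\<close> under j = r and j = - r.\<close>
  have "Xs = mat_s \<beta> X" "Xd = mat_d \<beta> X"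
    using mat_decomposition [OF assms(2)] assms(3-5) by blast+
  then have X: "Xs = map_matrix (subst_j r) X" "Xd = map_matrix (subst_j (- r)) X"
    by (simp_all add: vec_eq_iff mat_s_def mat_d_def map_matrix_def subst_j_def r_def tess_1_def
      tess_i_def zero_prod_def split: prod.split)
  have sqrt_iff: "is_sqrt_T \<alpha> \<beta> X R \<longleftrightarrow> is_sqrt_C \<alpha> \<beta> Xs (map_matrix (gsubst_j r) R) \<and>
      is_sqrt_C \<alpha> \<beta> Xd (map_matrix (gsubst_j (- r)) R)" for R
    unfolding X by (rule is_sqrt_T_iff [OF r])
  have combination_iff: "R = (1 / 2) *\<^sub>R (Rs + Rd) + mat_scale (gtess_mult \<alpha> \<beta>)
        ((1 / r) *\<^sub>R (Rs - (1 / 2) *\<^sub>R (Rs + Rd))) (of_tess tess_j) \<longleftrightarrow>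
      Rs = map_matrix (gsubst_j r) R \<and> Rd = map_matrix (gsubst_j (- r)) R"
    if "is_sqrt_C \<alpha> \<beta> Xs Rs" "is_sqrt_C \<alpha> \<beta> Xd Rd" for R Rs Rd
  proof (rule gtess_mat_eq_combination_iff [OF r(2)])
    show "entries_in (tess_C \<times> tess_C) Rs" "entries_in (tess_C \<times> tess_C) Rd"
      using that root_dom_C_subset unfolding is_sqrt_C_def is_sqrt_in_def entries_in_def by blast+
  qed
  \<comment> \<open>Given \<open>R\<close>, its two images serve as \<open>Rs\<close> and
    \<open>Rd\<close>. Conversely, roots \<open>Rs\<close> and \<open>Rd\<close> that combine to
    \<open>R\<close> must be these images, so \<open>sqrt_iff\<close> applies.\<close>
  have "is_sqrt_T \<alpha> \<beta> X R \<longleftrightarrow> (\<exists>Rs Rd. is_sqrt_C \<alpha> \<beta> Xs Rs \<and> is_sqrt_C \<alpha> \<beta> Xd Rd \<and>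
      R = (1 / 2) *\<^sub>R (Rs + Rd) + mat_scale (gtess_mult \<alpha> \<beta>)
        ((1 / r) *\<^sub>R (Rs - (1 / 2) *\<^sub>R (Rs + Rd))) (of_tess tess_j))" for R
    using sqrt_iff combination_iff by metis
  \<comment> \<open>The existence claim follows too: any choice of \<open>Rs\<close> and
    \<open>Rd\<close> can be inserted into the formula, independently of each other.\<close>
  then show ?thesis
    unfolding r_def by blast
qed

end
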